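(* Let $q=p^n$ with $p$ prime and $n\in\mathbb{Z}^+$, let $k$ be a positive divisor of $q-1$, and let $m=(q-1)/k$. Let $\chi$ be a generator of the (cyclic) group $\widehat{\mathbb{F}_q^{\times}}$ of multiplicative characters of $\mathbb{F}_q$, and let $$J_q(k):=\left[J_q(\chi^{ki},\chi^{kj})\right]_{1\le i,j\le m-1}.$$ Then: (i) $\det J_q(k)\in\mathbb{Z}$, and $\det J_q(k)$ does not depend on the choice of the generator $\chi$; (ii) $\det J_q(k)\equiv (-1)^{\frac{(k+1)(m^2-m)}{2}}\pmod p$.
   Context: Multiplicative characters $\psi:\mathbb{F}_q^\times\to\mathbb{C}^\times$ are extended to $\mathbb{F}_q$ by $\psi(0)=0$ (for every character, including the trivial one). For characters $\chi^i,\chi^j$, the Jacobi sum is $J_q(\chi^i,\chi^j):=\sum_{x\in\mathbb{F}_q}\chi^i(x)\chi^j(1-x)$. The determinant of an empty ($0\times 0$) matrix is $1$. *)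

theory Defs
  imports
    "HOL-Algebra.Generated_Groups"
    "HOL-Number_Theory.Cong"
    "HOL-Computational_Algebra.Primes"
    "HOL-Library.Cardinality"
    "Jordan_Normal_Form.Determinant"
begin

text \<open>A character of the unit group is represented by its extension by 0 to the whole field.\<close>

definition mult_character :: "('a::field \<Rightarrow> complex) \<Rightarrow> bool" where
  "mult_character \<psi> \<longleftrightarrow>
     \<psi> 0 = 0 \<and>
     (\<forall>x. x \<noteq> 0 \<longrightarrow> \<psi> x \<noteq> 0) \<and>
     (\<forall>x y. x \<noteq> 0 \<longrightarrow> y \<noteq> 0 \<longrightarrow> \<psi> (x * y) = \<psi> x * \<psi> y)"

text \<open>The trivial character vanishes at 0, so powers are taken with respect to the operations
  of this group: the 0-th power of a character has value 0, not 1, at 0.\<close>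

definition mult_character_group :: "('a::field \<Rightarrow> complex) monoid" where
  "mult_character_group =
     \<lparr>carrier = {\<psi>. mult_character \<psi>},
      monoid.mult = (\<lambda>\<psi> \<phi> x. \<psi> x * \<phi> x),
      one = (\<lambda>x. if x = 0 then 0 else 1)\<rparr>"

lemma comm_group_mult_character_group:
  "comm_group (mult_character_group :: ('a::field \<Rightarrow> complex) monoid)"
proof (rule comm_groupI)
  fix \<psi> :: "'a \<Rightarrow> complex"
  assume "\<psi> \<in> carrier mult_character_group"
  then have "mult_character \<psi>"
    by (simp add: mult_character_group_def)
  then have "mult_character (\<lambda>x. inverse (\<psi> x))"
    and "(\<lambda>x. inverse (\<psi> x) * \<psi> x) = (\<lambda>x. if x = 0 then 0 else 1)"
    by (auto simp: mult_character_def fun_eq_iff)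
  then show "\<exists>\<phi>\<in>carrier mult_character_group.
      \<phi> \<otimes>\<^bsub>mult_character_group\<^esub> \<psi> = \<one>\<^bsub>mult_character_group\<^esub>"
    by (intro bexI[of _ "\<lambda>x. inverse (\<psi> x)"]) (simp_all add: mult_character_group_def)
qed (auto simp: mult_character_group_def mult_character_def fun_eq_iff)

definition generates_mult_characters :: "('a::field \<Rightarrow> complex) \<Rightarrow> bool" where
  "generates_mult_characters \<chi> \<longleftrightarrow>
     \<chi> \<in> carrier mult_character_group \<and>
     generate mult_character_group {\<chi>} = carrier mult_character_group"

definition jacobi_sum :: "('a::{field,finite} \<Rightarrow> complex) \<Rightarrow> ('a \<Rightarrow> complex) \<Rightarrow> complex" where
  "jacobi_sum \<psi> \<phi> = (\<Sum>x\<in>UNIV. \<psi> x * \<phi> (1 - x))"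

text \<open>Matrix indices start at 0, hence the shift by one. For m = 1 the matrix is empty, and its
  determinant is 1.\<close>

definition jacobi_matrix :: "('a::{field,finite} \<Rightarrow> complex) \<Rightarrow> nat \<Rightarrow> complex mat" where
  "jacobi_matrix \<chi> k =
     (let m = (CARD('a) - 1) div k in
      mat (m - 1) (m - 1)
        (\<lambda>(i, j). jacobi_sum (\<chi> [^]\<^bsub>mult_character_group\<^esub> (k * (i + 1)))
                             (\<chi> [^]\<^bsub>mult_character_group\<^esub> (k * (j + 1)))))"

end

theory Submission
  imports Defs "HOL-Number_Theory.Residues"
begin

text \<open>
  Let \<open>g\<close> be a primitive root of the field, \<open>ind\<close> the discrete logarithm to base \<open>g\<close>, and
  \<open>w = \<chi>(g)\<^sup>k\<close>, a primitive \<open>m\<close>-th root of unity. The Jacobi sums are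
  \<open>\<Sum>\<^sub>x w\<^bsup>i ind(x) + j ind(1-x)\<^esup>\<close>, and since \<open>1 + w\<^sup>i + \<dots> + w\<^bsup>i(m-1)\<^esup> = 0\<close>, the Jacobi matrix
  factors as \<open>V M V\<close> with \<open>V = (w\<^bsup>ia\<^esup>)\<close> and \<open>M\<close> an integer matrix that depends only on \<open>g\<close>.
  As \<open>V V\<close> has the integer entries \<open>m [m | i + j] - 1\<close>, the determinant is an integer that
  depends neither on \<open>\<chi>\<close> nor on the field containing \<open>w\<close>. So it can be reduced modulo \<open>p\<close> by
  replacing \<open>w\<close> with \<open>g\<^sup>k\<close> in the finite field itself, without prime ideals of cyclotomic
  fields: the entries become \<open>\<Sum>\<^sub>x x\<^bsup>ki\<^esup> (1 - x)\<^bsup>kj\<^esup>\<close>, which are signed binomial coefficients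
  vanishing for \<open>i + j < m\<close>.
\<close>

section \<open>Determinants: sums of powers of a root of unity, and antitriangular matrices\<close>

text \<open>
  \<open>\<Sum>\<^sub>a w\<^bsup>ia\<^esup> * dual_root n c a = w\<^bsup>ic\<^esup>\<close>, where \<open>a\<close> runs through the nonzero residues modulo
  \<open>n + 1\<close>: the residue class of 0 is eliminated by the vanishing of the sum of all powers
  of \<open>w\<^sup>i\<close>. Indices are shifted by one as in \<open>jacobi_matrix\<close>.
\<close>

definition dual_root :: "nat \<Rightarrow> nat \<Rightarrow> nat \<Rightarrow> int" where
  "dual_root n c a =
     (if c mod Suc n = Suc a then 1 else 0) - (if c mod Suc n = 0 then 1 else 0)"

text \<open>The two factors are the determinants of \<open>V V\<close> and of \<open>M\<close>. The
  shifted indices lie between 1 and \<open>n\<close>, so their sum is divisible by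
  \<open>n + 1\<close> only if it equals \<open>n + 1\<close>; hence the condition
  \<open>i + j + 2 = Suc n\<close>.\<close>

definition root_sum_det :: "nat \<Rightarrow> 'b set \<Rightarrow> ('b \<Rightarrow> nat) \<Rightarrow> ('b \<Rightarrow> nat) \<Rightarrow> int" where
  "root_sum_det n X c d =
     det (mat n n (\<lambda>(i, j). (if i + j + 2 = Suc n then int (Suc n) else 0) - 1)) *
     det (mat n n (\<lambda>(a, b). \<Sum>x\<in>X. dual_root n (c x) a * dual_root n (d x) b))"

lemma power_eq_1_iff_dvd:
  fixes w :: "'r::monoid_mult"
  assumes "w ^ N = 1" and "\<And>t. 0 < t \<Longrightarrow> t < N \<Longrightarrow> w ^ t \<noteq> 1" and "N > 0"
  shows "w ^ t = 1 \<longleftrightarrow> N dvd t"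
proof -
  have "w ^ t = w ^ (N * (t div N) + t mod N)"
    by simp
  also have "\<dots> = w ^ (t mod N)"
    unfolding power_add power_mult assms(1) by simp
  finally have "w ^ t = w ^ (t mod N)" .
  then show ?thesis
    using assms(2)[of "t mod N"] \<open>N > 0\<close> by (cases "t mod N = 0") (auto simp: dvd_eq_mod_eq_0)
qed

lemma sum_powers_root:
  fixes w :: "'r::field"
  assumes "w ^ Suc n = 1"
  shows "(\<Sum>a<n. w ^ Suc a) = (if w = 1 then of_nat (Suc n) else 0) - 1"
proof -
  have "(\<Sum>a<Suc n. w ^ a) = (if w = 1 then of_nat (Suc n) else 0)"
    using assms by (subst sum_gp_strict) auto
  then show ?thesis
    by (subst (asm) sum.lessThan_Suc_shift) (simp add: algebra_simps)
qed

lemma sum_root_dual_root: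
  fixes w :: "'r::field"
  assumes w: "w ^ Suc n = 1" and prim: "\<And>t. 0 < t \<Longrightarrow> t < Suc n \<Longrightarrow> w ^ t \<noteq> 1"
    and "i < n"
  shows "(\<Sum>a<n. w ^ (Suc i * Suc a) * of_int (dual_root n c a)) = w ^ (Suc i * c)"
proof -
  define r where "r = c mod Suc n"
  define u where "u = w ^ Suc i"
  have u: "u ^ Suc n = 1"
    unfolding u_def by (metis w power_mult mult.commute power_one)
  have "u \<noteq> 1"
    unfolding u_def using prim[of "Suc i"] \<open>i < n\<close> by simp
  then have s: "(\<Sum>a<n. u ^ Suc a) = -1"
    using sum_powers_root[OF u] by simp
  have "u ^ c = u ^ (Suc n * (c div Suc n) + r)"
    unfolding r_def by (simp del: mult_Suc)
  also have "\<dots> = u ^ r"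
    unfolding power_add power_mult u by simp
  finally have c: "u ^ c = u ^ r" .
  have "(\<Sum>a<n. u ^ Suc a * of_int (dual_root n c a)) = u ^ r"
  proof (cases r)
    case 0
    then show ?thesis
      using s by (simp add: dual_root_def r_def sum_negf)
  next
    case (Suc b)
    then have "b < n"
      unfolding r_def by (metis Suc_less_eq mod_less_divisor zero_less_Suc)
    have "(\<Sum>a<n. u ^ Suc a * of_int (dual_root n c a)) = (\<Sum>a<n. if a = b then u ^ Suc b else 0)"
      using Suc by (intro sum.cong) (auto simp: dual_root_def r_def)
    then show ?thesis
      using \<open>b < n\<close> Suc by simp
  qed
  then show ?thesis
    using c by (simp only: u_def power_mult)
qed

text \<open>The field is arbitrary because this is applied twice with the same \<open>c\<close> and
  \<open>d\<close>: once to a complex \<open>w\<close>, once to an element \<open>w\<close> of the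
  finite field.\<close>

lemma det_root_sums:
  fixes w :: "'r::field"
  assumes w: "w ^ Suc n = 1" and prim: "\<And>t. 0 < t \<Longrightarrow> t < Suc n \<Longrightarrow> w ^ t \<noteq> 1"
  shows "det (mat n n (\<lambda>(i, j). \<Sum>x\<in>X. w ^ (Suc i * c x) * w ^ (Suc j * d x))) =
    of_int (root_sum_det n X c d)"
proof -
  define V where "V = mat n n (\<lambda>(i, a). w ^ (Suc i * Suc a))"
  define Q :: "int mat" where
    "Q = mat n n (\<lambda>(i, j). (if i + j + 2 = Suc n then int (Suc n) else 0) - 1)"
  define M where "M = mat n n (\<lambda>(a, b). \<Sum>x\<in>X. dual_root n (c x) a * dual_root n (d x) b)"
  have V: "V \<in> carrier_mat n n" and Q: "Q \<in> carrier_mat n n" and M: "M \<in> carrier_mat n n"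
    by (simp_all add: V_def Q_def M_def)
  have VV: "V * V = map_mat of_int Q"
  proof (rule eq_matI)
    fix i j
    assume ij: "i < dim_row (map_mat of_int Q)" "j < dim_col (map_mat of_int Q)"
    then have lt: "i < n" "j < n"
      by (simp_all add: Q_def)
    define u where "u = w ^ (Suc i + Suc j)"
    have "(V * V) $$ (i, j) = (\<Sum>a<n. u ^ Suc a)"
      using lt by (simp add: V_def scalar_prod_def u_def atLeast0LessThan algebra_simps
          flip: power_add power_mult)
    also have "\<dots> = (if u = 1 then of_nat (Suc n) else 0) - 1"
    proof (rule sum_powers_root)
      show "u ^ Suc n = 1"
        unfolding u_def by (metis w power_mult mult.commute power_one)
    qed
    also have "u = 1 \<longleftrightarrow> Suc n dvd Suc i + Suc j"
      unfolding u_def by (rule power_eq_1_iff_dvd[OF w prim]) auto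
    also have "\<dots> \<longleftrightarrow> i + j + 2 = Suc n"
    proof
      assume "Suc n dvd Suc i + Suc j"
      then obtain b where b: "Suc i + Suc j = Suc n * b" ..
      then have "Suc n * b < Suc n * 2"
        unfolding b[symmetric] using lt by simp
      then have "b < 2"
        by (simp del: mult_Suc)
      moreover have "b \<noteq> 0"
        using b by (intro notI) simp
      ultimately have "b = 1"
        by simp
      then show "i + j + 2 = Suc n"
        using b by simp
    qed simp
    finally show "(V * V) $$ (i, j) = map_mat of_int Q $$ (i, j)"
      using lt by (simp add: Q_def)
  qed (simp_all add: V_def Q_def)
  have VMV: "mat n n (\<lambda>(i, j). \<Sum>x\<in>X. w ^ (Suc i * c x) * w ^ (Suc j * d x)) =
    V * (map_mat of_int M * V)"
  proof (rule eq_matI)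
    fix i j
    assume "i < dim_row (V * (map_mat of_int M * V))" "j < dim_col (V * (map_mat of_int M * V))"
    then have lt: "i < n" "j < n"
      by (simp_all add: V_def)
    have "(V * (map_mat of_int M * V)) $$ (i, j) =
      (\<Sum>a<n. w ^ (Suc i * Suc a) * (\<Sum>b<n. (\<Sum>x\<in>X. of_int (dual_root n (c x) a) *
         of_int (dual_root n (d x) b)) * w ^ (Suc b * Suc j)))"
      using lt by (simp add: V_def M_def scalar_prod_def atLeast0LessThan
          del: mult_Suc mult_Suc_right power_Suc)
    also have "\<dots> = (\<Sum>a<n. \<Sum>b<n. \<Sum>x\<in>X.
        (w ^ (Suc i * Suc a) * of_int (dual_root n (c x) a)) *
        (w ^ (Suc j * Suc b) * of_int (dual_root n (d x) b)))"
      unfolding sum_distrib_left sum_distrib_right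
      by (intro sum.cong refl) (simp only: mult_ac)
    \<comment> \<open>With the sum over \<open>X\<close> outermost, the sums over \<open>a\<close>
      and \<open>b\<close> separate into a product.\<close>
    also have "\<dots> = (\<Sum>x\<in>X. \<Sum>a<n. \<Sum>b<n.
        (w ^ (Suc i * Suc a) * of_int (dual_root n (c x) a)) *
        (w ^ (Suc j * Suc b) * of_int (dual_root n (d x) b)))"
      by (simp only: sum.swap[where B = X])
    also have "\<dots> = (\<Sum>x\<in>X. w ^ (Suc i * c x) * w ^ (Suc j * d x))"
      unfolding sum_product[symmetric] using lt
      by (simp only: sum_root_dual_root[OF w prim])
    finally show "mat n n (\<lambda>(i, j). \<Sum>x\<in>X. w ^ (Suc i * c x) * w ^ (Suc j * d x)) $$ (i, j) =
        (V * (map_mat of_int M * V)) $$ (i, j)"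
      using lt by simp
  qed (simp_all add: V_def)
  \<comment> \<open>\<open>det V\<close> depends on \<open>w\<close> and is never evaluated: its two
    occurrences are joined into \<open>det (V * V)\<close>, the image of an integer.\<close>
  have "det (V * (map_mat of_int M * V)) = det V * (det (map_mat of_int M) * det V)"
    using V M by (simp add: det_mult[of _ n])
  also have "\<dots> = det (V * V) * det (map_mat of_int M)"
    using V by (simp add: det_mult[of _ n])
  also have "\<dots> = of_int (det Q * det M)"
    by (simp add: VV)
  finally show ?thesis
    by (simp only: VMV root_sum_det_def Q_def M_def)
qed

text \<open>Expand along the first row: only its last entry survives, and the remaining minor has
  the same shape, with \<open>f\<close> replaced by its shift in the row index.\<close>

lemma det_antitriangular:
  fixes f :: "nat \<Rightarrow> nat \<Rightarrow> 'r::comm_ring_1"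
  assumes "\<And>i j. Suc (i + j) < n \<Longrightarrow> f i j = 0"
  shows "det (mat n n (\<lambda>(i, j). f i j)) = (\<Prod>j<n. (-1) ^ j * f (n - 1 - j) j)"
  using assms
proof (induction n arbitrary: f)
  case 0
  then show ?case by simp
next
  case (Suc n)
  define A where "A = mat (Suc n) (Suc n) (\<lambda>(i, j). f i j)"
  have "det A = (\<Sum>j<Suc n. A $$ (0, j) * cofactor A 0 j)"
    by (rule laplace_expansion_row) (simp_all add: A_def)
  also have "\<dots> = (\<Sum>j<n. A $$ (0, j) * cofactor A 0 j) + f 0 n * cofactor A 0 n"
    by (simp add: A_def)
  also have "(\<Sum>j<n. A $$ (0, j) * cofactor A 0 j) = 0"
    using Suc.prems[of 0] by (intro sum.neutral) (auto simp: A_def)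
  also have "mat_delete A 0 n = mat n n (\<lambda>(i, j). f (Suc i) j)"
    by (rule eq_matI) (auto simp: mat_delete_def A_def)
  then have "cofactor A 0 n = (-1) ^ n * (\<Prod>j<n. (-1) ^ j * f (Suc (n - 1 - j)) j)"
    unfolding cofactor_def using Suc.IH[of "\<lambda>i. f (Suc i)"] Suc.prems by simp
  also have "(\<Prod>j<n. (-1) ^ j * f (Suc (n - 1 - j)) j) = (\<Prod>j<n. (-1) ^ j * f (n - j) j)"
    by (intro prod.cong) (auto simp: Suc_diff_Suc)
  finally show ?case
    by (simp add: A_def mult_ac)
qed

section \<open>Finite fields: primitive roots, power sums and their determinant\<close>

text \<open>Multiplication by \<open>x\<close> permutes the nonzero elements, so it leaves their
  product unchanged.\<close>

lemma finite_field_power_card_minus_1: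
  fixes x :: "'a::{field,finite}"
  assumes "x \<noteq> 0"
  shows "x ^ (CARD('a) - 1) = 1"
proof -
  have "(\<Prod>y\<in>-{0}. x * y) = (\<Prod>y\<in>-{0::'a}. y)"
    by (rule prod.reindex_bij_witness[of _ "\<lambda>y. y / x" "\<lambda>y. x * y"]) (use assms in auto)
  then have "x ^ card (-{0::'a}) * (\<Prod>y\<in>-{0::'a}. y) = (\<Prod>y\<in>-{0::'a}. y)"
    by (simp add: prod.distrib)
  then show ?thesis
    by (simp add: Compl_eq_Diff_UNIV)
qed

lemma CARD_field_minus_1_pos: "CARD('a::{field,finite}) - 1 > 0"
  using card_mono[of UNIV "{0, 1::'a}"] by simp

text \<open>Cyclicity of the unit group comes from the theory of fields with an explicit carrier, so
  the type is wrapped as a record \<open>R\<close> and the generator is carried back.\<close>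

lemma finite_field_primitive_root:
  obtains g :: "'a::{field,finite}"
  where "g \<noteq> 0" "bij_betw (\<lambda>i. g ^ i) {..<CARD('a) - 1} (-{0})"
proof -
  define R :: "'a ring" where
    "R = \<lparr>carrier = UNIV, monoid.mult = (*), one = 1, ring.zero = 0, add = (+)\<rparr>"
  have "cring R"
  proof (intro cringI abelian_groupI comm_monoidI)
    fix x
    show "\<exists>y\<in>carrier R. y \<oplus>\<^bsub>R\<^esub> x = \<zero>\<^bsub>R\<^esub>"
      by (intro bexI[of _ "- x"]) (simp_all add: R_def)
  qed (auto simp: R_def algebra_simps)
  then interpret cring R .
  interpret field R
  proof (rule cring_fieldI2)
    fix a
    assume "a \<in> carrier R" "a \<noteq> \<zero>\<^bsub>R\<^esub>"
    then show "\<exists>b\<in>carrier R. a \<otimes>\<^bsub>R\<^esub> b = \<one>\<^bsub>R\<^esub>"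
      by (intro bexI[of _ "inverse a"]) (simp_all add: R_def)
  qed (simp add: R_def)
  have pow: "x [^]\<^bsub>R\<^esub> (i::nat) = x ^ i" for x i
    by (induction i) (simp_all add: R_def nat_pow_def)
  obtain g where "g \<in> carrier (mult_of R)" "carrier (mult_of R) = {g [^]\<^bsub>R\<^esub> i | i::nat. i \<in> UNIV}"
    using finite_field_mult_group_has_gen by (auto simp: R_def)
  then have g: "g \<noteq> 0" "-{0} = range (\<lambda>i. g ^ i)"
    by (auto simp: pow) (auto simp: R_def)
  have "(\<lambda>i. g ^ i) ` {..<CARD('a) - 1} = -{0}"
  proof
    show "-{0} \<subseteq> (\<lambda>i. g ^ i) ` {..<CARD('a) - 1}"
    proof
      fix x :: 'a
      assume "x \<in> -{0}"
      then obtain i where i: "x = g ^ i"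
        using g(2) by auto
      also have "g ^ i = g ^ ((CARD('a) - 1) * (i div (CARD('a) - 1)) + i mod (CARD('a) - 1))"
        by simp
      also have "\<dots> = g ^ (i mod (CARD('a) - 1))"
        unfolding power_add power_mult finite_field_power_card_minus_1[OF g(1)] by simp
      finally show "x \<in> (\<lambda>i. g ^ i) ` {..<CARD('a) - 1}"
        using CARD_field_minus_1_pos[where ?'a = 'a] by auto
    qed
  qed (use g(1) in auto)
  moreover from this have "inj_on (\<lambda>i. g ^ i) {..<CARD('a) - 1}"
    by (intro eq_card_imp_inj_on) (simp_all add: Compl_eq_Diff_UNIV)
  ultimately show ?thesis
    using g(1) by (intro that) (auto simp: bij_betw_def)
qed

lemma primitive_root_power_eq_1_iff:
  fixes g :: "'a::{field,finite}"
  assumes "g \<noteq> 0" and "bij_betw (\<lambda>i. g ^ i) {..<CARD('a) - 1} (-{0})"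
  shows "g ^ t = 1 \<longleftrightarrow> CARD('a) - 1 dvd t"
proof (rule power_eq_1_iff_dvd[OF finite_field_power_card_minus_1[OF assms(1)]])
  fix t
  assume "0 < t" "t < CARD('a) - 1"
  then show "g ^ t \<noteq> 1"
    using bij_betw_imp_inj_on[OF assms(2)] by (auto dest: inj_onD[where x = t and y = 0])
qed (rule CARD_field_minus_1_pos)

text \<open>For a primitive root \<open>g\<close> this is a geometric sum with ratio
  \<open>g ^ t\<close>. If the ratio is 1, there are q - 1 terms, and q is 0 in the field. Since
  \<open>t > 0\<close>, the point 0 contributes nothing.\<close>

lemma sum_finite_field_power:
  assumes "t > 0"
  shows "(\<Sum>x\<in>UNIV. (x::'a::{field,finite}) ^ t) = (if CARD('a) - 1 dvd t then -1 else 0)"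
proof -
  obtain g :: 'a where g: "g \<noteq> 0" "bij_betw (\<lambda>i. g ^ i) {..<CARD('a) - 1} (-{0})"
    by (rule finite_field_primitive_root)
  have "(\<Sum>x\<in>UNIV. (x::'a) ^ t) = (\<Sum>x\<in>-{0::'a}. x ^ t)"
    using assms by (intro sum.mono_neutral_right) auto
  also have "\<dots> = (\<Sum>i<CARD('a) - 1. (g ^ t) ^ i)"
    using sum.reindex_bij_betw[OF g(2), of "\<lambda>x. x ^ t"]
    by (simp add: mult.commute flip: power_mult)
  also have "\<dots> = (if g ^ t = 1 then of_nat (CARD('a) - 1) else 0)"
    using finite_field_power_card_minus_1[of "g ^ t"] g(1) by (subst sum_gp_strict) simp
  also have "of_nat (CARD('a) - 1) = (-1 :: 'a)"
    using CARD_field_minus_1_pos[where ?'a = 'a] CHAR_dvd_CARD[where ?'a = 'a]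
    by (simp add: of_nat_diff of_nat_eq_0_iff_char_dvd)
  finally show ?thesis
    by (simp add: primitive_root_power_eq_1_iff[OF g])
qed

text \<open>Expand \<open>(1 - x) ^ b\<close> and sum each monomial over the field. The exponents
  \<open>a + s\<close> lie strictly between 0 and 2(q - 1), so only \<open>a + s\<close> = q - 1
  survives.\<close>

lemma sum_power_mult_power_one_minus:
  assumes "a > 0" and "a < CARD('a::{field,finite}) - 1" and "b < CARD('a) - 1"
  shows "(\<Sum>x\<in>UNIV. (x::'a) ^ a * (1 - x) ^ b) =
    - ((-1) ^ (CARD('a) - 1 - a) * of_nat (b choose (CARD('a) - 1 - a)))"
proof -
  define N where "N = CARD('a) - 1"
  have dvd_iff: "N dvd a + s \<longleftrightarrow> s = N - a" if "s \<le> b" for s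
  proof
    assume "N dvd a + s"
    then obtain c where c: "a + s = N * c" ..
    then have "N * c < N * 2" "N * c > 0"
      unfolding c[symmetric] using assms that by (simp_all add: N_def)
    then have "c = 1"
      by auto
    then show "s = N - a"
      using c by simp
  qed (use assms in \<open>simp add: N_def\<close>)
  have pw: "(\<Sum>x\<in>UNIV. (x::'a) ^ (a + s)) = (if s = N - a then -1 else 0)" if "s \<le> b" for s
    using sum_finite_field_power[of "a + s", where ?'a = 'a] dvd_iff[OF that] assms(1)
    unfolding N_def[symmetric] by simp
  have "(\<Sum>x\<in>UNIV. (x::'a) ^ a * (1 - x) ^ b) =
    (\<Sum>x\<in>UNIV. \<Sum>s\<le>b. of_nat (b choose s) * (-1) ^ s * x ^ (a + s))"
  proof (intro sum.cong refl)
    fix x :: 'a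
    have "(1 - x) ^ b = (\<Sum>s\<le>b. of_nat (b choose s) * (- x) ^ s)"
      using binomial_ring[of "- x" 1 b] by simp
    then show "x ^ a * (1 - x) ^ b = (\<Sum>s\<le>b. of_nat (b choose s) * (-1) ^ s * x ^ (a + s))"
      by (simp add: sum_distrib_left power_minus[of x] power_add mult_ac)
  qed
  also have "\<dots> = (\<Sum>s\<le>b. of_nat (b choose s) * (-1) ^ s * (\<Sum>x\<in>UNIV. (x::'a) ^ (a + s)))"
    by (subst sum.swap) (simp add: sum_distrib_left)
  also have "\<dots> = (\<Sum>s\<le>b. if s = N - a then - ((-1) ^ (N - a) * of_nat (b choose (N - a))) else 0)"
    using pw by (intro sum.cong refl) auto
  \<comment> \<open>If \<open>N - a\<close> exceeds \<open>b\<close>, no summand survives, and the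
    binomial coefficient is 0 as well.\<close>
  also have "\<dots> = - ((-1) ^ (N - a) * of_nat (b choose (N - a)))"
    by (auto simp: binomial_eq_0)
  finally show ?thesis
    by (simp add: N_def)
qed

text \<open>Up to sign, the entries are the binomial coefficients of \<open>k * Suc j\<close> over
  \<open>k * (n - i)\<close>. They vanish for \<open>i + j + 1 < n\<close> and are 1 for
  \<open>i + j + 1 = n\<close>, so the determinant is a product of signs.\<close>

lemma det_power_sums:
  assumes "k * Suc n = CARD('a::{field,finite}) - 1" and "k > 0"
  shows "det (mat n n (\<lambda>(i, j). \<Sum>x\<in>UNIV. (x::'a) ^ (k * Suc i) * (1 - x) ^ (k * Suc j))) =
    (-1) ^ ((k + 1) * (\<Sum>j<n. Suc j))"
proof -
  define f :: "nat \<Rightarrow> nat \<Rightarrow> 'a" where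
    "f = (\<lambda>i j. - ((-1) ^ (k * (n - i)) * of_nat ((k * Suc j) choose (k * (n - i)))))"
  have "mat n n (\<lambda>(i, j). \<Sum>x\<in>UNIV. (x::'a) ^ (k * Suc i) * (1 - x) ^ (k * Suc j)) =
    mat n n (\<lambda>(i, j). f i j)"
  proof (rule eq_matI)
    fix i j
    assume "i < dim_row (mat n n (\<lambda>(i, j). f i j))" "j < dim_col (mat n n (\<lambda>(i, j). f i j))"
    then have lt: "i < n" "j < n"
      by simp_all
    have "k * Suc i < k * Suc n" "k * Suc j < k * Suc n"
      using lt \<open>k > 0\<close> by (simp_all del: mult_Suc_right)
    moreover have "k * Suc n - k * Suc i = k * (n - i)"
      by (simp add: diff_mult_distrib2)
    ultimately show "mat n n (\<lambda>(i, j). \<Sum>x\<in>UNIV. (x::'a) ^ (k * Suc i) * (1 - x) ^ (k * Suc j))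
        $$ (i, j) = mat n n (\<lambda>(i, j). f i j) $$ (i, j)"
      using lt \<open>k > 0\<close> assms(1)
        sum_power_mult_power_one_minus[of "k * Suc i" "k * Suc j", where ?'a = 'a]
      by (simp add: f_def del: mult_Suc_right)
  qed simp_all
  also have "det \<dots> = (\<Prod>j<n. (-1) ^ j * f (n - 1 - j) j)"
    using \<open>k > 0\<close> by (intro det_antitriangular) (simp add: f_def binomial_eq_0 del: mult_Suc_right)
  also have "\<dots> = (\<Prod>j<n. (-1) ^ ((k + 1) * Suc j))"
  proof (intro prod.cong refl)
    fix j
    assume "j \<in> {..<n}"
    \<comment> \<open>On the antidiagonal the binomial coefficient is 1. The expansion sign
      \<open>(-1) ^ j\<close> and the minus sign in \<open>f\<close> combine to
      \<open>(-1) ^ Suc j\<close>.\<close>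
    then have e: "n - (n - 1 - j) = Suc j"
      by auto
    then show "(-1) ^ j * f (n - 1 - j) j = (-1) ^ ((k + 1) * Suc j)"
      unfolding f_def e by (simp add: power_add algebra_simps)
  qed
  also have "\<dots> = (-1) ^ ((k + 1) * (\<Sum>j<n. Suc j))"
    by (simp only: sum_distrib_left power_sum)
  finally show ?thesis .
qed

section \<open>Multiplicative characters\<close>

lemma mult_character_mult:
  "mult_character \<psi> \<Longrightarrow> \<psi> (x * y) = \<psi> x * \<psi> y"
  by (cases "x = 0 \<or> y = 0") (auto simp: mult_character_def)

lemma mult_character_one: "mult_character \<psi> \<Longrightarrow> \<psi> 1 = 1"
  using mult_character_mult[of \<psi> 1 1] by (auto simp: mult_character_def)

lemma mult_character_power: "mult_character \<psi> \<Longrightarrow> \<psi> (x ^ i) = \<psi> x ^ i"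
  by (induction i) (simp_all add: mult_character_one mult_character_mult)

text \<open>The point 0 is separate because of \<open>t = 0\<close>: the trivial character is 0
  there, whereas \<open>0 ^ 0 = 1\<close>.\<close>

lemma mult_character_group_pow:
  assumes "mult_character \<chi>"
  shows "(\<chi> [^]\<^bsub>mult_character_group\<^esub> (t::nat)) x = (if x = 0 then 0 else \<chi> x ^ t)"
  using assms by (induction t) (auto simp: mult_character_group_def nat_pow_def mult_character_def)

lemma exists_faithful_mult_character:
  fixes g :: "'a::{field,finite}"
  assumes g: "g \<noteq> 0" "bij_betw (\<lambda>i. g ^ i) {..<CARD('a) - 1} (-{0})"
  obtains \<psi> :: "'a \<Rightarrow> complex"
  where "mult_character \<psi>" "\<And>t. 0 < t \<Longrightarrow> t < CARD('a) - 1 \<Longrightarrow> \<psi> g ^ t \<noteq> 1"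
proof -
  define N where "N = CARD('a) - 1"
  have "N > 0"
    unfolding N_def by (rule CARD_field_minus_1_pos)
  define z where "z = cis (2 * pi / real N)"
  have z_pow: "z ^ t = cis (2 * pi * real t / real N)" for t
    by (simp add: z_def DeMoivre mult.commute)
  have zN: "z ^ N = 1"
    using \<open>N > 0\<close> by (simp add: z_pow)
  have z_ne: "z ^ t \<noteq> 1" if "0 < t" "t < N" for t
    using bij_betw_roots_unity[OF \<open>N > 0\<close>] that
    unfolding bij_betw_def z_pow[symmetric] by (auto dest: inj_onD[where x = t and y = 0])
  define ind where "ind = inv_into {..<N} (\<lambda>i. g ^ i)"
  have ind: "g ^ ind x = x" if "x \<noteq> 0" for x
    unfolding ind_def using that bij_betw_inv_into_right[OF g(2)] by (simp add: N_def)
  \<comment> \<open>This makes \<open>g ^ i\<close> to \<open>z ^ i\<close> well defined. It is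
    needed because \<open>ind\<close> is additive only modulo \<open>N\<close>.\<close>
  have z_eq: "z ^ i = z ^ j" if "g ^ i = g ^ j" for i j
    using that
  proof (induction i j rule: linorder_wlog)
    case (le i j)
    then have "g ^ i * g ^ (j - i) = g ^ i"
      by (metis le_add_diff_inverse power_add)
    then have "N dvd j - i"
      using primitive_root_power_eq_1_iff[OF g] g(1) by (simp add: N_def)
    then have "z ^ (j - i) = 1"
      using power_eq_1_iff_dvd[OF zN z_ne \<open>N > 0\<close>] by simp
    then show ?case
      using power_add[of z i "j - i"] le by simp
  qed (metis)
  define \<psi> where "\<psi> = (\<lambda>x. if x = 0 then 0 else z ^ ind x)"
  have "mult_character \<psi>"
    unfolding mult_character_def
  proof (intro conjI allI impI)
    fix x y :: 'a
    assume xy: "x \<noteq> 0" "y \<noteq> 0"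
    then have "z ^ ind (x * y) = z ^ (ind x + ind y)"
      by (intro z_eq) (simp add: ind power_add)
    then show "\<psi> (x * y) = \<psi> x * \<psi> y"
      using xy by (simp add: \<psi>_def power_add)
  qed (auto simp: \<psi>_def z_def)
  \<comment> \<open>In the field with two elements \<open>ind g\<close> is 0 rather than 1, so the
    exponents are compared through \<open>z_eq\<close>.\<close>
  moreover have "\<psi> g = z"
    using z_eq[of "ind g" 1] g(1) ind by (simp add: \<psi>_def)
  ultimately show ?thesis
    using z_ne by (intro that) (auto simp: N_def)
qed

text \<open>If \<open>t\<close> killed the value of the generator at \<open>g\<close>, it would kill
  the value at \<open>g\<close> of every character, including the faithful one just
  constructed.\<close>

lemma generating_character_primitive:
  fixes g :: "'a::{field,finite}"
  assumes g: "g \<noteq> 0" "bij_betw (\<lambda>i. g ^ i) {..<CARD('a) - 1} (-{0})"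
    and gen: "generates_mult_characters \<chi>" and t: "0 < t" "t < CARD('a) - 1"
  shows "\<chi> g ^ t \<noteq> 1"
proof
  let ?G = "mult_character_group :: ('a \<Rightarrow> complex) monoid"
  interpret comm_group ?G
    by (rule comm_group_mult_character_group)
  assume 1: "\<chi> g ^ t = 1"
  have \<chi>: "\<chi> \<in> carrier ?G" and G: "generate ?G {\<chi>} = carrier ?G"
    using gen by (auto simp: generates_mult_characters_def)
  have "\<psi> g ^ t = 1" if "\<psi> \<in> generate ?G {\<chi>}" for \<psi>
    using that
  proof (induction rule: generate.induct)
    case one
    then show ?case
      using g(1) by (simp add: mult_character_group_def)
  next
    case (incl h)
    then show ?case
      using 1 by simp
  next
    case (inv h)
    then have "h = \<chi>"
      by simp
    then have "(inv\<^bsub>?G\<^esub> h \<otimes>\<^bsub>?G\<^esub> \<chi>) g = \<one>\<^bsub>?G\<^esub> g"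
      using l_inv[OF \<chi>] by simp
    moreover have "(\<phi> \<otimes>\<^bsub>?G\<^esub> \<chi>) g = \<phi> g * \<chi> g" for \<phi>
      by (simp add: mult_character_group_def)
    moreover have "\<one>\<^bsub>?G\<^esub> g = 1"
      using g(1) by (simp add: mult_character_group_def)
    ultimately have "(inv\<^bsub>?G\<^esub> h) g * \<chi> g = 1"
      by simp
    then have "(inv\<^bsub>?G\<^esub> h) g ^ t * \<chi> g ^ t = 1"
      by (simp flip: power_mult_distrib)
    then show ?case
      using 1 by simp
  next
    case (eng h1 h2)
    then show ?case
      by (simp add: mult_character_group_def power_mult_distrib)
  qed
  moreover obtain \<psi> :: "'a \<Rightarrow> complex" where
    "mult_character \<psi>" "\<And>t. 0 < t \<Longrightarrow> t < CARD('a) - 1 \<Longrightarrow> \<psi> g ^ t \<noteq> 1"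
    using exists_faithful_mult_character[OF g] by blast
  ultimately show False
    using t G by (auto simp: mult_character_group_def)
qed

section \<open>The Jacobi determinant as an integer, and its residue modulo \<open>p\<close>\<close>

lemma det_jacobi_matrix:
  fixes g :: "'a::{field,finite}" and ind :: "'a \<Rightarrow> nat" and \<chi> :: "'a \<Rightarrow> complex"
  assumes g: "g \<noteq> 0" "bij_betw (\<lambda>i. g ^ i) {..<CARD('a) - 1} (-{0})"
    and ind: "\<And>x. x \<noteq> 0 \<Longrightarrow> g ^ ind x = x"
    and k: "k * Suc n = CARD('a) - 1"
    and gen: "generates_mult_characters \<chi>"
  shows "det (jacobi_matrix \<chi> k) = of_int (root_sum_det n (-{0, 1}) ind (\<lambda>x. ind (1 - x)))"
proof -
  have \<chi>: "mult_character \<chi>"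
    using gen by (simp add: generates_mult_characters_def mult_character_group_def)
  have "k > 0"
    using k CARD_field_minus_1_pos[where ?'a = 'a] by (cases k) auto
  then have n: "(CARD('a) - 1) div k - 1 = n"
    unfolding k[symmetric] by simp
  define w where "w = \<chi> g ^ k"
  have \<chi>_ind: "\<chi> x ^ (k * t) = w ^ (t * ind x)" if "x \<noteq> 0" for x t
  proof -
    have "\<chi> x = \<chi> g ^ ind x"
      using ind[OF that] mult_character_power[OF \<chi>] by metis
    then show ?thesis
      by (simp add: w_def mult_ac flip: power_mult)
  qed
  \<comment> \<open>At 0 and 1 one of the two characters vanishes. Omitting these points also avoids
    \<open>ind 0\<close>, about which nothing is assumed.\<close>
  have "jacobi_matrix \<chi> k = mat n n (\<lambda>(i, j). \<Sum>x\<in>-{0, 1}.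
      w ^ (Suc i * ind x) * w ^ (Suc j * ind (1 - x)))"
    unfolding jacobi_matrix_def Let_def n
  proof (intro cong_mat refl, clarsimp simp del: mult_Suc mult_Suc_right)
    fix i j
    show "jacobi_sum (\<chi> [^]\<^bsub>mult_character_group\<^esub> (k * Suc i))
        (\<chi> [^]\<^bsub>mult_character_group\<^esub> (k * Suc j)) =
      (\<Sum>x\<in>-{0, 1}. w ^ (Suc i * ind x) * w ^ (Suc j * ind (1 - x)))"
      unfolding jacobi_sum_def mult_character_group_pow[OF \<chi>]
      by (intro sum.mono_neutral_cong_right)
        (auto simp: \<chi>_ind simp del: mult_Suc mult_Suc_right)
  qed
  also have "det \<dots> = of_int (root_sum_det n (-{0, 1}) ind (\<lambda>x. ind (1 - x)))"
  proof (rule det_root_sums)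
    show "w ^ Suc n = 1"
      unfolding w_def power_mult[symmetric] k mult_character_power[OF \<chi>, symmetric]
      by (simp only: finite_field_power_card_minus_1[OF g(1)] mult_character_one[OF \<chi>])
    fix t
    assume "0 < t" "t < Suc n"
    then have "0 < k * t" "k * t < CARD('a) - 1"
      unfolding k[symmetric] using \<open>k > 0\<close> by (simp_all del: mult_Suc_right)
    then show "w ^ t \<noteq> 1"
      unfolding w_def power_mult[symmetric] by (rule generating_character_primitive[OF g gen])
  qed
  finally show ?thesis .
qed

text \<open>Here \<open>g ^ k\<close> takes the place of the complex root of unity, and its powers
  turn the discrete logarithms back into powers of \<open>x\<close> and
  \<open>1 - x\<close>.\<close>

lemma of_int_root_sum_det_finite_field:
  fixes g :: "'a::{field,finite}" and ind :: "'a \<Rightarrow> nat"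
  assumes g: "g \<noteq> 0" "bij_betw (\<lambda>i. g ^ i) {..<CARD('a) - 1} (-{0})"
    and ind: "\<And>x. x \<noteq> 0 \<Longrightarrow> g ^ ind x = x"
    and k: "k * Suc n = CARD('a) - 1"
  shows "of_int (root_sum_det n (-{0, 1}) ind (\<lambda>x. ind (1 - x))) =
    ((-1) ^ ((k + 1) * (\<Sum>j<n. Suc j)) :: 'a)"
proof -
  have "k > 0"
    using k CARD_field_minus_1_pos[where ?'a = 'a] by (cases k) auto
  have ind': "(g ^ k) ^ (t * ind x) = x ^ (k * t)" if "x \<noteq> 0" for x t
  proof -
    have "(g ^ k) ^ (t * ind x) = (g ^ ind x) ^ (k * t)"
      by (simp add: mult_ac flip: power_mult)
    then show ?thesis
      by (simp add: ind[OF that])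
  qed
  have "of_int (root_sum_det n (-{0, 1}) ind (\<lambda>x. ind (1 - x))) =
    det (mat n n (\<lambda>(i, j). \<Sum>x\<in>-{0, 1}.
      (g ^ k) ^ (Suc i * ind x) * (g ^ k) ^ (Suc j * ind (1 - x))))"
  proof (rule det_root_sums[symmetric])
    show "(g ^ k) ^ Suc n = 1"
      unfolding power_mult[symmetric] k by (rule finite_field_power_card_minus_1[OF g(1)])
    fix t
    assume "0 < t" "t < Suc n"
    then have "0 < k * t" "k * t < CARD('a) - 1"
      unfolding k[symmetric] using \<open>k > 0\<close> by (simp_all del: mult_Suc_right)
    then show "(g ^ k) ^ t \<noteq> 1"
      unfolding power_mult[symmetric] primitive_root_power_eq_1_iff[OF g]
      using nat_dvd_not_less by blast
  qed
  also have "mat n n (\<lambda>(i, j). \<Sum>x\<in>-{0, 1}.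
      (g ^ k) ^ (Suc i * ind x) * (g ^ k) ^ (Suc j * ind (1 - x))) =
    mat n n (\<lambda>(i, j). \<Sum>x\<in>UNIV. (x::'a) ^ (k * Suc i) * (1 - x) ^ (k * Suc j))"
  proof (intro cong_mat refl, clarsimp simp del: mult_Suc mult_Suc_right power_Suc)
    fix i j
    show "(\<Sum>x\<in>-{0, 1}. (g ^ k) ^ (Suc i * ind x) * (g ^ k) ^ (Suc j * ind (1 - x))) =
      (\<Sum>x\<in>UNIV. (x::'a) ^ (k * Suc i) * (1 - x) ^ (k * Suc j))"
      \<comment> \<open>The points 0 and 1 can be restored because both exponents are
        positive.\<close>
      using \<open>k > 0\<close> by (intro sum.mono_neutral_cong_left)
        (auto simp: ind' simp del: mult_Suc mult_Suc_right)
  qed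
  also have "det \<dots> = (-1) ^ ((k + 1) * (\<Sum>j<n. Suc j))"
    using k \<open>k > 0\<close> by (rule det_power_sums)
  finally show ?thesis .
qed

lemma CHAR_finite_field:
  assumes "prime p" and "CARD('a::{field,finite}) = p ^ n"
  shows "CHAR('a) = p"
proof -
  have "prime CHAR('a)"
    by (intro prime_CHAR_semidom finite_imp_CHAR_pos) simp
  then show ?thesis
    using CHAR_dvd_CARD[where ?'a = 'a] assms by (metis prime_dvd_power primes_dvd_imp_eq)
qed

theorem theorem1p1:
  fixes p n q k m :: nat
    and \<chi> :: "'a::{field,finite} \<Rightarrow> complex"
  assumes "prime p" and "n \<ge> 1" and "q = p ^ n"
    and "CARD('a) = q"
    and "k > 0" and "k dvd q - 1" and "m = (q - 1) div k"
    and "generates_mult_characters \<chi>"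
  shows "det (jacobi_matrix \<chi> k) \<in> \<int> \<and>
         (\<forall>\<chi>' :: 'a \<Rightarrow> complex. generates_mult_characters \<chi>' \<longrightarrow>
            det (jacobi_matrix \<chi>' k) = det (jacobi_matrix \<chi> k)) \<and>
         (\<exists>D :: int. det (jacobi_matrix \<chi> k) = of_int D \<and>
            [D = (-1) ^ (((k + 1) * (m\<^sup>2 - m)) div 2)] (mod int p))"
proof -
  have km: "k * m = CARD('a) - 1"
    using assms by simp
  then have "m > 0"
    using CARD_field_minus_1_pos[where ?'a = 'a] by (cases m) auto
  define l where "l = m - 1"
  have m: "m = Suc l"
    using \<open>m > 0\<close> by (simp add: l_def)
  have k: "k * Suc l = CARD('a) - 1"
    using km by (simp add: m)
  obtain g :: 'a where g: "g \<noteq> 0" "bij_betw (\<lambda>i. g ^ i) {..<CARD('a) - 1} (-{0})"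
    by (rule finite_field_primitive_root)
  define ind where "ind = inv_into {..<CARD('a) - 1} (\<lambda>i. g ^ i)"
  have ind: "g ^ ind x = x" if "x \<noteq> 0" for x
    unfolding ind_def using that bij_betw_inv_into_right[OF g(2)] by simp
  \<comment> \<open>\<open>D\<close> is built from \<open>g\<close> and \<open>ind\<close> alone, so
    it serves every generating character at once.\<close>
  define D where "D = root_sum_det l (-{0, 1}) ind (\<lambda>x. ind (1 - x))"
  have det: "det (jacobi_matrix \<phi> k) = of_int D"
    if "generates_mult_characters \<phi>" for \<phi> :: "'a \<Rightarrow> complex"
    unfolding D_def by (rule det_jacobi_matrix[OF g ind k that])
  have "2 * (\<Sum>j<l. Suc j) = m\<^sup>2 - m"
    unfolding m by (induction l) (simp_all add: power2_eq_square)
  then have "((k + 1) * (m\<^sup>2 - m)) div 2 = (k + 1) * (\<Sum>j<l. Suc j)"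
    by (metis mult.left_commute nonzero_mult_div_cancel_left zero_neq_numeral)
  then have "of_int D = (of_int ((-1) ^ (((k + 1) * (m\<^sup>2 - m)) div 2)) :: 'a)"
    unfolding D_def using of_int_root_sum_det_finite_field[OF g ind k] by simp
  \<comment> \<open>Integers with the same image in a field of characteristic \<open>p\<close> are
    congruent modulo \<open>p\<close>.\<close>
  then have "[D = (-1) ^ (((k + 1) * (m\<^sup>2 - m)) div 2)] (mod int p)"
    unfolding of_int_eq_iff_cong_CHAR using CHAR_finite_field assms by metis
  then show ?thesis
    using det assms by auto
qed

end
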